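(* Let $n,m,s,N$ be positive integers with $s\le m$, $n>2s$ and $\frac{n-1}{n-2s}\leq N\leq s$. Then for almost all $\lambda_0\in\mathbb{C}^n$, almost all $A\in\mathbb{C}^{n\times m}$, and almost all $X_0\in\mathbb{C}^{m\times N}$ with $s$ nonzero rows, the pair $(\lambda_0,X_0)$ is identifiable up to scaling in the BGPC problem with a joint sparsity constraint: whenever $\lambda\in\mathbb{C}^n$ and $X\in\mathbb{C}^{m\times N}$ with at most $s$ nonzero rows satisfy $\operatorname{diag}(\lambda)AX=\operatorname{diag}(\lambda_0)AX_0$, there exists a nonzero $\sigma\in\mathbb{C}$ with $\lambda=\sigma\lambda_0$ and $X=\frac{1}{\sigma}X_0$.
   Context: $\operatorname{diag}(\lambda)$ denotes the $n\times n$ diagonal matrix with the entries of $\lambda$ on its diagonal. The BGPC problem with a joint sparsity constraint is: given $A$ and $Y=\operatorname{diag}(\lambda_0)AX_0$, find $(\lambda,X)$ with $\lambda\in\mathbb{C}^n$, $X\in\mathbb{C}^{m\times N}$ having at most $s$ nonzero rows (columns jointly $s$-sparse), and $\operatorname{diag}(\lambda)AX=Y$. "Almost all $X_0$ with $s$ nonzero rows" means: for each index set $J_0\subset\{1,\dots,m\}$ with $|J_0|=s$, the statement holds for all $X_0$ whose rows outside $J_0$ vanish, except for those whose submatrix of rows indexed by $J_0$ lies in a Lebesgue-null subset of $\mathbb{C}^{s\times N}$; "almost all" for $\lambda_0$ and $A$ is with respect to Lebesgue measure on $\mathbb{C}^n$ and $\mathbb{C}^{n\times m}$ (identifying $\mathbb{C}\cong\mathbb{R}^2$).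 *)

theory Defs
  imports "HOL-Analysis.Analysis"
begin

definition diag_mat :: "'a::zero ^ 'n \<Rightarrow> 'a ^ 'n ^ 'n" where
  "diag_mat l = (\<chi> i j. if i = j then l $ i else 0)"

definition nonzero_rows :: "'a::zero ^ 'k ^ 'm \<Rightarrow> 'm set" where
  "nonzero_rows X = {i. X $ i \<noteq> 0}"

definition rows_on :: "'m set \<Rightarrow> 'a::zero ^ 'k ^ 'm \<Rightarrow> 'a ^ 'k ^ 'm" where
  "rows_on J Z = (\<chi> i. if i \<in> J then Z $ i else 0)"

end

theory Submission
  imports Defs
begin

text \<open>If \<open>\<lambda>\<close> and \<open>\<lambda>\<^sub>0\<close> have no zero entries, put \<open>\<mu> = \<lambda>\<^sub>0 / \<lambda>\<close>. The equation becomes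
  \<open>A X = diag(\<mu>) A X\<^sub>0\<close>, which is linear in \<open>(\<mu>, X)\<close> and has the solution \<open>(1, X\<^sub>0)\<close>. It suffices that
  for each set \<open>K\<close> of at most \<open>2 s\<close> rows that contains the support of \<open>X\<^sub>0\<close>, the solutions with \<open>X\<close>
  supported on \<open>K\<close> form a line, i.e. that there is no nonzero solution whose \<open>\<mu>\<close> vanishes at a fixed
  index \<open>i0\<close>. Injectivity of a matrix that depends polynomially on parameters holds almost everywhere
  as soon as it holds at one point, so a single pair \<open>(A, X\<^sub>0)\<close> per \<open>K\<close> is enough.

  In that pair the nonzero columns of \<open>A\<close> are a basis of the orthogonal complement \<open>V\<close> of some vectors
  \<open>b\<^sub>q\<close>, and the columns \<open>a\<^sub>k\<close> of \<open>A X\<^sub>0\<close> are chosen such that the entrywise products of \<open>a\<^sub>k\<close> and \<open>b\<^sub>q\<close>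
  are \<open>e\<^sub>i - e\<^sub>i\<^sub>0\<close> for all \<open>i \<noteq> i0\<close>. As \<open>\<mu> a\<^sub>k\<close> lies in \<open>V\<close>, all entries of \<open>\<mu>\<close> agree.\<close>

section \<open>Functions polynomial along lines and generic injectivity\<close>

text \<open>Stands in for complex-valued multivariate polynomials on a real space. It is all that
  the null-set argument uses: it is stable under sums and products, and continuity supplies
  measurability.\<close>

definition poly_on_lines :: "('a::euclidean_space \<Rightarrow> complex) \<Rightarrow> bool" where
  "poly_on_lines f \<longleftrightarrow> continuous_on UNIV f \<and>
     (\<forall>x v. \<exists>p. \<forall>t::real. f (x + t *\<^sub>R v) = poly p (of_real t))"

lemma poly_on_lines_const [intro]: "poly_on_lines (\<lambda>_. c)"
  unfolding poly_on_lines_def by (auto intro!: exI[of _ "[:c:]"])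

lemma poly_on_lines_linear:
  assumes "linear f"
  shows "poly_on_lines f"
proof -
  interpret linear f by fact
  have "f (x + t *\<^sub>R v) = poly [:f x, f v:] (of_real t)" for x v t
    by (simp add: add scale scaleR_conv_of_real)
  then show ?thesis
    unfolding poly_on_lines_def
    using linear_continuous_on[of f UNIV] assms linear_conv_bounded_linear by blast
qed

lemma poly_on_lines_if [intro]:
  assumes "b \<Longrightarrow> poly_on_lines f" "\<not> b \<Longrightarrow> poly_on_lines g"
  shows "poly_on_lines (\<lambda>x. if b then f x else g x)"
  using assms by (cases b) auto

lemma poly_on_lines_add [intro]:
  assumes "poly_on_lines f" "poly_on_lines g"
  shows "poly_on_lines (\<lambda>x. f x + g x)"
  using assms unfolding poly_on_lines_def
  by (auto intro!: continuous_intros) (metis poly_add)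

lemma poly_on_lines_mult [intro]:
  assumes "poly_on_lines f" "poly_on_lines g"
  shows "poly_on_lines (\<lambda>x. f x * g x)"
  using assms unfolding poly_on_lines_def
  by (auto intro!: continuous_intros) (metis poly_mult)

lemma poly_on_lines_sum [intro]:
  assumes "\<And>i. i \<in> I \<Longrightarrow> poly_on_lines (f i)"
  shows "poly_on_lines (\<lambda>x. \<Sum>i\<in>I. f i x)"
  using assms by (induction I rule: infinite_finite_induct) auto

lemma poly_on_lines_prod [intro]:
  assumes "\<And>i. i \<in> I \<Longrightarrow> poly_on_lines (f i)"
  shows "poly_on_lines (\<lambda>x. \<Prod>i\<in>I. f i x)"
  using assms by (induction I rule: infinite_finite_induct) auto

lemma poly_on_lines_det:
  fixes M :: "'a::euclidean_space \<Rightarrow> complex ^ 'n ^ 'n"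
  assumes "\<And>i j. poly_on_lines (\<lambda>x. M x $ i $ j)"
  shows "poly_on_lines (\<lambda>x. det (M x))"
  unfolding det_def
  by (intro poly_on_lines_sum poly_on_lines_mult poly_on_lines_prod poly_on_lines_const assms)

text \<open>On each line through \<open>a\<close> the function has finitely many zeros. Hence by Fubini, for almost every
  \<open>t\<close> the set of all \<open>y\<close> with \<open>f (a + t y) = 0\<close>, a rescaled copy of the zero set of \<open>f\<close>, is null.\<close>
lemma AE_poly_on_lines_nonzero:
  fixes f :: "'a::euclidean_space \<Rightarrow> complex"
  assumes f: "poly_on_lines f" and nz: "f a \<noteq> 0"
  shows "AE x in lborel. f x \<noteq> 0"
proof -
  have cont: "continuous_on UNIV f"
    using f by (simp add: poly_on_lines_def)
  have [measurable]: "f \<in> borel_measurable borel"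
    using cont by (rule borel_measurable_continuous_onI)
  have "AE y in lborel. AE t::real in lborel. f (a + t *\<^sub>R y) \<noteq> 0"
  proof (rule AE_I2)
    fix y
    obtain p where p: "\<And>t::real. f (a + t *\<^sub>R y) = poly p (of_real t)"
      using f unfolding poly_on_lines_def by blast
    have "p \<noteq> 0"
      using p[of 0] nz by auto
    then have "finite {z. poly p z = 0}"
      by (rule poly_roots_finite)
    then have "finite (complex_of_real -` {z. poly p z = 0})"
      by (rule finite_vimageI) (simp add: inj_of_real)
    then have "complex_of_real -` {z. poly p z = 0} \<in> null_sets lborel"
      using finite_imp_null_set_lborel by blast
    then show "AE t::real in lborel. f (a + t *\<^sub>R y) \<noteq> 0"
      by (rule AE_I') (auto simp: p)
  qed
  then have "AE t::real in lborel. AE y in lborel. f (a + t *\<^sub>R y) \<noteq> 0"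
    by (subst lborel_pair.AE_commute) measurable
  then have "AE t::real in lborel. t \<noteq> 0 \<and> (AE y in lborel. f (a + t *\<^sub>R y) \<noteq> 0)"
    using AE_lborel_singleton[of "0::real"] by eventually_elim simp
  moreover have "ae_filter (lborel :: real measure) \<noteq> bot"
    by (simp add: trivial_limit_def[symmetric] eventually_ae_filter ae_filter_eq_bot_iff)
  ultimately obtain t :: real where t: "t \<noteq> 0" and ae: "AE y in lborel. f (a + t *\<^sub>R y) \<noteq> 0"
    using eventually_happens by blast
  show ?thesis
    by (subst lborel_affine[OF t, of a]) (use ae in \<open>simp add: AE_density AE_distr_iff\<close>)
qed

text \<open>A left inverse \<open>B\<close> of \<open>M a\<close> makes the rectangular problem
  square: \<open>det (B ** M x)\<close> is polynomial along lines and equals 1 at \<open>a\<close>,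
  and wherever it is nonzero, \<open>M x\<close> has trivial kernel.\<close>

lemma AE_matrix_injective:
  fixes M :: "'a::euclidean_space \<Rightarrow> complex ^ 'c ^ 'r"
  assumes M: "\<And>i j. poly_on_lines (\<lambda>x. M x $ i $ j)"
    and inj: "\<And>v. M a *v v = 0 \<Longrightarrow> v = 0"
  shows "AE x in lborel. \<forall>v. M x *v v = 0 \<longrightarrow> v = 0"
proof -
  obtain B where B: "B ** M a = mat 1"
    using inj matrix_left_invertible_ker[of "M a"] by blast
  have "poly_on_lines (\<lambda>x. (B ** M x) $ i $ j)" for i j
    unfolding matrix_matrix_mult_def vec_lambda_beta
    by (intro poly_on_lines_sum poly_on_lines_mult poly_on_lines_const M)
  then have "poly_on_lines (\<lambda>x. det (B ** M x))"
    by (rule poly_on_lines_det)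
  then have "AE x in lborel. det (B ** M x) \<noteq> 0"
    by (rule AE_poly_on_lines_nonzero[of _ a]) (simp add: B)
  then show ?thesis
  proof eventually_elim
    case (elim x)
    then have "invertible (B ** M x)"
      by (simp add: invertible_det_nz)
    then have "\<forall>v. (B ** M x) *v v = 0 \<longrightarrow> v = 0"
      using matrix_left_invertible_ker[of "B ** M x"] invertible_def by blast
    then show ?case
      by (metis matrix_vector_mul_assoc matrix_vector_mult_0_right)
  qed
qed

section \<open>One explicit pair with trivial kernel\<close>

lemma matrix_mult_rows_on_nth:
  "(A ** rows_on J Z) $ i $ k = (\<Sum>j\<in>J. A $ i $ j * Z $ j $ k)"
  for A :: "'a::semiring_1 ^ 'm::finite ^ 'n"
  unfolding matrix_matrix_mult_def rows_on_def vec_lambda_beta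
  by (rule sum.mono_neutral_cong_right) auto

text \<open>Deal the elements of \<open>Q\<close> out to the rows \<open>T\<close> in turn: by the
  first inequality every row receives one, by the second they all fit into \<open>card P\<close>
  cells per row. Apart from \<open>i0\<close>, these rows become the supports of the vectors
  \<open>a k\<close> with \<open>k \<noteq> k0\<close>.\<close>

lemma surj_with_disjoint_rows:
  assumes fin: "finite P" "finite Q" "finite T"
    and le: "card T \<le> card Q" "card Q \<le> card T * card P"
  obtains F where "\<And>k q. k \<in> T \<Longrightarrow> q \<in> P \<Longrightarrow> F k q \<in> Q"
    and "\<And>k q k' q'. \<lbrakk>k \<in> T; k' \<in> T; q \<in> P; q' \<in> P; F k q = F k' q'\<rbrakk> \<Longrightarrow> k = k'"
    and "\<And>i. i \<in> Q \<Longrightarrow> \<exists>k\<in>T. \<exists>q\<in>P. F k q = i"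
proof -
  obtain eT where eT: "bij_betw eT T {..<card T}"
    using fin(3) by (metis ex_bij_betw_finite_nat lessThan_atLeast0)
  obtain eP where eP: "bij_betw eP P {..<card P}"
    using fin(1) by (metis ex_bij_betw_finite_nat lessThan_atLeast0)
  obtain eQ where eQ: "bij_betw eQ {..<card Q} Q"
    using fin(2) by (metis ex_bij_betw_nat_finite lessThan_atLeast0)
  \<comment> \<open>Division with remainder by \<open>card T\<close> reads off row and column; overflowing cells of row \<open>k\<close>
    repeat the first cell of that row.\<close>
  define c where "c k q = (let i = eP q * card T + eT k in if i < card Q then i else eT k)" for k q
  have eT_less: "eT k < card T" if "k \<in> T" for k
    using bij_betwE[OF eT] that by auto
  have c_less: "c k q < card Q" if "k \<in> T" for k q
    using eT_less[OF that] le(1) by (auto simp: c_def Let_def)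
  have c_mod: "c k q mod card T = eT k" if "k \<in> T" for k q
    using eT_less[OF that] by (auto simp: c_def Let_def)
  show ?thesis
  proof (rule that[of "\<lambda>k q. eQ (c k q)"])
    show "eQ (c k q) \<in> Q" if "k \<in> T" for k q
      using bij_betwE[OF eQ] c_less[OF that] by auto
    show "k = k'" if "k \<in> T" "k' \<in> T" "eQ (c k q) = eQ (c k' q')" for k q k' q'
    proof -
      have "c k q = c k' q'"
        using that c_less bij_betw_imp_inj_on[OF eQ] by (auto dest: inj_onD)
      then have "eT k = eT k'"
        using c_mod that by metis
      then show ?thesis
        using that bij_betw_imp_inj_on[OF eT] by (auto dest: inj_onD)
    qed
    show "\<exists>k\<in>T. \<exists>q\<in>P. eQ (c k q) = i" if i: "i \<in> Q" for i
    proof -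
      obtain j where j: "j < card Q" "eQ j = i"
        using i bij_betw_imp_surj_on[OF eQ] by (metis imageE lessThan_iff)
      then have "card T > 0"
        using le(2) by (cases "card T") auto
      then have "j mod card T < card T"
        by simp
      then obtain k where k: "k \<in> T" "eT k = j mod card T"
        using bij_betw_imp_surj_on[OF eT] by (metis imageE lessThan_iff)
      have "j div card T < card P"
        using j(1) le(2) by (simp add: less_mult_imp_div_less mult.commute)
      then obtain q where q: "q \<in> P" "eP q = j div card T"
        using bij_betw_imp_surj_on[OF eP] by (metis imageE lessThan_iff)
      have "c k q = j"
        using j by (simp add: c_def k q Let_def)
      then show ?thesis
        using k q j by blast
    qed
  qed
qed


text \<open>There are \<open>CARD('n) - card K\<close> vectors \<open>b\<^sub>q\<close>, so their
  complement has dimension \<open>card K\<close>, the number of nonzero columns of \<open>A\<close>.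
  Each of the \<open>CARD('N)\<close> vectors \<open>a k\<close> is paired with each
  \<open>b\<^sub>q\<close>, and \<open>bound\<close> says that these pairs suffice to reach all
  indices other than \<open>i0\<close>.\<close>

lemma ex_trivial_kernel:
  fixes J K :: "'m::finite set" and i0 :: "'n::finite"
  assumes sub: "J \<subseteq> K" and N_le: "CARD('N::finite) \<le> card J" and K_less: "card K < CARD('n)"
    and bound: "CARD('n) - 1 \<le> CARD('N) * (CARD('n) - card K)"
  obtains A :: "complex ^ 'm ^ 'n" and Z :: "complex ^ 'N ^ 'm"
  where "\<And>\<mu> X. \<lbrakk>\<And>i k. (A ** X) $ i $ k = \<mu> $ i * (A ** rows_on J Z) $ i $ k;
      \<And>j. j \<notin> K \<Longrightarrow> X $ j = 0; \<mu> $ i0 = 0\<rbrakk> \<Longrightarrow> \<mu> = 0 \<and> X = 0"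
proof -
  fix k0 :: 'N
  define d where "d = CARD('n) - card K"
  have N_le_K: "CARD('N) \<le> card K"
    using N_le card_mono[OF _ sub] by (simp add: le_trans)
  have N_pos: "0 < CARD('N)"
    by simp
  have card_i0: "card (UNIV - {i0}) = CARD('n) - 1"
    by (simp add: card_Diff_singleton)
  have "d \<le> card (UNIV - {i0})"
    unfolding card_i0 d_def using N_le_K N_pos by linarith
  then obtain P where P: "P \<subseteq> UNIV - {i0}" "card P = d"
    using obtain_subset_with_card_n by metis
  define Q where "Q = UNIV - {i0} - P"
  have card_Q: "card Q = card K - 1"
    unfolding Q_def using P card_i0 K_less N_le_K N_pos
    by (simp add: card_Diff_subset d_def)
  have "P \<noteq> {}"
    using P K_less by (auto simp: d_def)
  then obtain q0 where q0: "q0 \<in> P"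
    by blast
  have card_T: "card (UNIV - {k0}) = CARD('N) - 1"
    by (simp add: card_Diff_singleton)
  \<comment> \<open>Row \<open>k0\<close> will hold the \<open>d\<close> indices in
    \<open>P\<close>; leaving it out takes \<open>d\<close> from both sides of
    \<open>bound\<close>.\<close>
  have Q_le: "card Q \<le> card (UNIV - {k0}) * card P"
    using bound K_less N_le_K N_pos unfolding card_T card_Q P(2) d_def
    by (simp add: diff_mult_distrib)
  have Q_ge: "card (UNIV - {k0}) \<le> card Q"
    using N_le_K unfolding card_T card_Q by simp
  obtain F' where F'_mem: "\<And>k q. k \<in> UNIV - {k0} \<Longrightarrow> q \<in> P \<Longrightarrow> F' k q \<in> Q"
    and F'_inj: "\<And>k q k' q'. \<lbrakk>k \<in> UNIV - {k0}; k' \<in> UNIV - {k0}; q \<in> P; q' \<in> P; F' k q = F' k' q'\<rbrakk> \<Longrightarrow> k = k'"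
    and F'_surj: "\<And>i. i \<in> Q \<Longrightarrow> \<exists>k\<in>UNIV - {k0}. \<exists>q\<in>P. F' k q = i"
    using surj_with_disjoint_rows[OF finite finite finite Q_ge Q_le] by blast
  \<comment> \<open>Row \<open>k0\<close> is the identity on \<open>P\<close> and the other rows
    stay inside \<open>Q\<close>. Hence \<open>b\<^sub>q\<close> meets \<open>P\<close> only at
    \<open>q\<close>, and the entries on \<open>P\<close> of a vector orthogonal to all
    \<open>b\<^sub>q\<close> are determined by the others.\<close>
  define F where "F k q = (if k = k0 then q else F' k q)" for k q
  have F_Q: "F k q \<in> Q" if "k \<noteq> k0" "q \<in> P" for k q
    using F'_mem that by (simp add: F_def)
  have F_k0: "F k0 q = q" for q
    by (simp add: F_def)
  have F_P: "F k q \<in> P \<longleftrightarrow> k = k0" if "q \<in> P" for k q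
    using F_Q[of k q] that by (auto simp: F_k0 Q_def)
  have F_ne: "F k q \<noteq> i0" if "q \<in> P" for k q
    using F_Q[of k q] that P by (cases "k = k0") (auto simp: Q_def F_k0)
  have F_inj: "k = k'" if "q \<in> P" "q' \<in> P" "F k q = F k' q'" for k k' q q'
  proof (cases "k = k0 \<or> k' = k0")
    case True
    then show ?thesis
      using F_P that by metis
  next
    case False
    then show ?thesis
      using F'_inj that by (auto simp: F_def)
  qed
  have F_surj: "\<exists>k. \<exists>q\<in>P. F k q = i" if "i \<noteq> i0" for i
  proof (cases "i \<in> P")
    case True
    then show ?thesis
      using F_k0 by blast
  next
    case False
    then have "i \<in> Q"
      using that by (simp add: Q_def)
    then obtain k q where "k \<noteq> k0" "q \<in> P" "F' k q = i"
      using F'_surj by blast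
    then show ?thesis
      by (metis F_def)
  qed

  \<comment> \<open>The columns \<open>g k\<close> of \<open>A\<close> will carry the vectors
    \<open>a k\<close>; they lie in \<open>J\<close> so that \<open>rows_on J\<close> keeps the
    matching rows of \<open>Z\<close>.\<close>
  obtain g :: "'N \<Rightarrow> 'm" where g: "range g \<subseteq> J" "inj g"
    using card_le_inj[of "UNIV :: 'N set" J] N_le by auto
  \<comment> \<open>\<open>E\<close> holds one index from each row other than \<open>k0\<close>.
    Keeping all \<open>r j\<close> outside \<open>E\<close> lets the index \<open>F k q0\<close>
    isolate the column \<open>g k\<close>. The count is exact: both differences have
    \<open>card K - CARD('N)\<close> elements.\<close>
  define E where "E = (\<lambda>k. F k q0) ` (UNIV - {k0})"
  have E_sub: "E \<subseteq> Q"
    using F_Q q0 by (auto simp: E_def)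
  have card_E: "card E = CARD('N) - 1"
    unfolding E_def by (subst card_image) (auto intro!: inj_onI dest: F_inj[OF q0 q0] simp: card_T)
  have "card (K - range g) \<le> card (Q - E)"
    using E_sub g sub card_E card_Q
    by (subst (1 2) card_Diff_subset) (auto simp: card_image)
  then obtain r where r: "r ` (K - range g) \<subseteq> Q - E" "inj_on r (K - range g)"
    using card_le_inj[of "K - range g" "Q - E"] by auto

  \<comment> \<open>The vector \<open>b\<^sub>q\<close> has entry \<open>1\<close> at all \<open>F k q\<close> and \<open>- 1\<close> at \<open>i0\<close>. The vectors \<open>a k\<close> are orthogonal
    to all of them, and \<open>b j\<close> is the \<open>r j\<close>-th unit vector, corrected on \<open>P\<close> to be orthogonal as well.\<close>
  define a where "a k i = (if i = i0 \<or> i \<in> F k ` P then 1 else 0 :: complex)" for k i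
  define b where "b j i = (if i \<in> P then - (\<Sum>k\<in>UNIV - {k0}. of_bool (F k i = r j))
    else of_bool (i = r j) :: complex)" for j i
  define A :: "complex ^ 'm ^ 'n" where
    "A = (\<chi> i j. if j \<in> range g then a (the_inv g j) i else if j \<in> K then b j i else 0)"
  \<comment> \<open>Row \<open>g k\<close> is the \<open>k\<close>-th unit vector, so
    \<open>A ** rows_on J Z\<close> has the columns \<open>a k\<close>.\<close>
  define Z :: "complex ^ 'N ^ 'm" where "Z = (\<chi> j k. of_bool (j = g k))"

  have A_g: "A $ i $ g k = a k i" for i k
    by (simp add: A_def the_inv_f_f[OF g(2)])
  have A_b: "A $ i $ j = b j i" if "j \<in> K - range g" for i j
    using that by (simp add: A_def)
  have a_F: "a k (F k' q) = of_bool (k' = k)" if "q \<in> P" for k k' q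
    using that F_ne[of q k'] F_inj[of q _ k' k] by (auto simp: a_def)
  have AZ: "(A ** rows_on J Z) $ i $ k = a k i" for i k
  proof -
    have "g k \<in> J"
      using g(1) by blast
    then show ?thesis
      by (simp add: matrix_mult_rows_on_nth Z_def of_bool_def if_distrib A_g cong: if_cong)
  qed
  \<comment> \<open>This is orthogonality of column \<open>j\<close> to \<open>b\<^sub>q\<close>,
    with the entry at \<open>i0\<close> moved to the right.\<close>
  have col: "(\<Sum>k\<in>UNIV. A $ F k q $ j) = A $ i0 $ j" if q: "q \<in> P" for q j
  proof -
    consider k where "j = g k" | "j \<in> K - range g" | "j \<notin> K" "j \<notin> range g"
      by blast
    then show ?thesis
    proof cases
      case (1 k)
      then show ?thesis
        using q by (simp add: A_g a_F of_bool_def sum.delta) (simp add: a_def)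
    next
      case 2
      then have rj: "r j \<in> Q"
        using r by auto
      have "(\<Sum>k\<in>UNIV. b j (F k q)) = b j q + (\<Sum>k\<in>UNIV - {k0}. b j (F k q))"
        by (subst sum.remove[of _ k0]) (auto simp: F_k0)
      also have "(\<Sum>k\<in>UNIV - {k0}. b j (F k q)) = (\<Sum>k\<in>UNIV - {k0}. of_bool (F k q = r j))"
        using F_Q[OF _ q] by (intro sum.cong) (auto simp: b_def Q_def)
      finally have "(\<Sum>k\<in>UNIV. b j (F k q)) = 0"
        using q by (simp add: b_def)
      moreover have "b j i0 = 0"
        using rj P by (auto simp: b_def Q_def)
      ultimately show ?thesis
        using 2 by (simp add: A_b)
    qed (simp add: A_def)
  qed
  have "\<mu> = 0 \<and> X = 0"
    if eq: "\<And>i k. (A ** X) $ i $ k = \<mu> $ i * (A ** rows_on J Z) $ i $ k"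
      and supp: "\<And>j. j \<notin> K \<Longrightarrow> X $ j = 0" and 0: "\<mu> $ i0 = 0" for \<mu> X
  proof -
    have "\<mu> $ F k q = 0" if q: "q \<in> P" for k q
    proof -
      \<comment> \<open>Among the indices \<open>F k' q\<close>, only \<open>F k q\<close> lies in
        the support of \<open>a k\<close>. The sum is thus one half of the pairing of
        \<open>\<mu> a\<^sub>k\<close> with \<open>b\<^sub>q\<close>, and \<open>col\<close> equates
        it with the entry at \<open>i0\<close>.\<close>
      have "\<mu> $ F k q = (\<Sum>k'\<in>UNIV. \<mu> $ F k' q * a k (F k' q))"
        using q by (simp add: a_F of_bool_def if_distrib cong: if_cong)
      also have "\<dots> = (\<Sum>k'\<in>UNIV. \<Sum>j\<in>UNIV. A $ F k' q $ j * X $ j $ k)"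
        using eq[unfolded AZ] by (simp add: matrix_matrix_mult_def)
      also have "\<dots> = (\<Sum>j\<in>UNIV. (\<Sum>k'\<in>UNIV. A $ F k' q $ j) * X $ j $ k)"
        by (subst sum.swap) (simp add: sum_distrib_right)
      also have "\<dots> = (A ** X) $ i0 $ k"
        using q by (simp add: col matrix_matrix_mult_def)
      finally show ?thesis
        using eq[of i0 k] 0 by simp
    qed
    then have \<mu>: "\<mu> $ i = 0" for i
      using F_surj[of i] 0 by metis
    have zero: "(\<Sum>j\<in>UNIV. A $ i $ j * X $ j $ l) = 0" for i l
      using eq[of i l] \<mu> by (simp add: matrix_matrix_mult_def)
    \<comment> \<open>The columns of \<open>A\<close> are independent: each step picks an index
      where only one column can still contribute. First \<open>F k q0\<close> isolates
      \<open>g k\<close> for \<open>k \<noteq> k0\<close>, then \<open>i0\<close> isolates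
      \<open>g k0\<close>, and finally \<open>r j\<close> isolates each remaining \<open>j\<close>
      in \<open>K\<close>.\<close>
    have "X $ j $ l = 0" for j l
    proof -
      have single: "A $ i $ j * X $ j $ l = 0" if "\<And>j'. j' \<noteq> j \<Longrightarrow> A $ i $ j' * X $ j' $ l = 0" for i j
      proof -
        have "(\<Sum>j'\<in>UNIV. A $ i $ j' * X $ j' $ l) = A $ i $ j * X $ j $ l"
          by (subst sum.remove[of _ j]) (auto intro!: sum.neutral that)
        then show ?thesis
          using zero by simp
      qed
      have other: "A $ i $ j' * X $ j' $ l = 0" if "j' \<notin> range g" "i \<notin> P" "j' \<in> K \<Longrightarrow> r j' \<noteq> i" for i j'
        using that supp[of j'] by (cases "j' \<in> K") (auto simp: A_b b_def)
      have X_g: "X $ g k $ l = 0" if k: "k \<noteq> k0" for k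
      proof -
        have "A $ F k q0 $ g k * X $ g k $ l = 0"
        proof (rule single)
          fix j' assume j': "j' \<noteq> g k"
          show "A $ F k q0 $ j' * X $ j' $ l = 0"
          proof (cases "j' \<in> range g")
            case True
            then obtain k' where "j' = g k'" "k' \<noteq> k"
              using j' by auto
            then show ?thesis
              using q0 by (simp add: A_g a_F)
          next
            case False
            have "F k q0 \<in> E"
              using k by (auto simp: E_def)
            then show ?thesis
              using False r(1) E_sub by (intro other) (auto simp: Q_def)
          qed
        qed
        then show ?thesis
          using q0 by (simp add: A_g a_F)
      qed
      have "A $ i0 $ g k0 * X $ g k0 $ l = 0"
      proof (rule single)
        fix j' assume j': "j' \<noteq> g k0"
        show "A $ i0 $ j' * X $ j' $ l = 0"
        proof (cases "j' \<in> range g")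
          case True
          then obtain k where "j' = g k" "k \<noteq> k0"
            using j' by auto
          then show ?thesis
            by (simp add: X_g)
        next
          case False
          then show ?thesis
            using r(1) P(1) by (intro other) (auto simp: Q_def)
        qed
      qed
      then have X_range: "X $ j $ l = 0" if "j \<in> range g" for j
        using that X_g by (auto simp: A_g a_def) metis
      show ?thesis
      proof (cases "j \<in> K - range g")
        case True
        have rj: "r j \<in> Q"
          using True r(1) by auto
        have "A $ r j $ j * X $ j $ l = 0"
        proof (rule single)
          fix j' assume j': "j' \<noteq> j"
          show "A $ r j $ j' * X $ j' $ l = 0"
          proof (cases "j' \<in> range g")
            case False
            then show ?thesis
              using rj True j' r(2) by (intro other) (auto simp: Q_def dest: inj_onD)
          qed (simp add: X_range)
        qed
        then show ?thesis
          using True rj by (simp add: A_b b_def Q_def)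
      next
        case False
        then show ?thesis
          using X_range supp by auto
      qed
    qed
    then show ?thesis
      using \<mu> by (simp add: vec_eq_iff)
  qed
  then show thesis
    using that by blast
qed

section \<open>The linear system as a single matrix\<close>

text \<open>The rows \<open>Inl\<close> encode \<open>A X = diag(\<mu>) Y\<close>, the others \<open>supp X \<subseteq> K\<close> and \<open>\<mu> $ i0 = 0\<close>.\<close>
definition calib_matrix ::
    "'n \<Rightarrow> 'm set \<Rightarrow> complex ^ 'm ^ 'n \<Rightarrow> complex ^ 'N ^ 'n \<Rightarrow>
      complex ^ ('n + 'm \<times> 'N) ^ ('n \<times> 'N + 'm \<times> 'N + unit)"
  where "calib_matrix i0 K A Y = (\<chi> t col. case t of
      Inl (i, k) \<Rightarrow> (case col of Inl i' \<Rightarrow> (if i' = i then - Y $ i $ k else 0)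
        | Inr (j, k') \<Rightarrow> (if k' = k then A $ i $ j else 0))
    | Inr (Inl (j, k)) \<Rightarrow> of_bool (j \<notin> K \<and> col = Inr (j, k))
    | Inr (Inr _) \<Rightarrow> of_bool (col = Inl i0))"

definition flatten :: "complex ^ 'n \<Rightarrow> complex ^ 'N ^ 'm \<Rightarrow> complex ^ ('n + 'm \<times> 'N)" where
  "flatten \<mu> X = (\<chi> c. case c of Inl i \<Rightarrow> \<mu> $ i | Inr (j, k) \<Rightarrow> X $ j $ k)"

lemma sum_UNIV_sum:
  fixes f :: "'a::finite + 'b::finite \<Rightarrow> 'c::comm_monoid_add"
  shows "sum f UNIV = (\<Sum>x\<in>UNIV. f (Inl x)) + (\<Sum>x\<in>UNIV. f (Inr x))"
  by (simp add: UNIV_Plus_UNIV[symmetric] sum.Plus del: UNIV_Plus_UNIV)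

lemma sum_UNIV_prod:
  fixes f :: "'a::finite \<times> 'b::finite \<Rightarrow> 'c::comm_monoid_add"
  shows "sum f UNIV = (\<Sum>x\<in>UNIV. \<Sum>y\<in>UNIV. f (x, y))"
  by (simp add: UNIV_Times_UNIV[symmetric] sum.cartesian_product del: UNIV_Times_UNIV)

lemma calib_matrix_kernel_iff:
  fixes A :: "complex ^ 'm::finite ^ 'n::finite" and Y :: "complex ^ 'N::finite ^ 'n"
  shows "calib_matrix i0 K A Y *v flatten \<mu> X = 0 \<longleftrightarrow>
    (\<forall>i k. (A ** X) $ i $ k = \<mu> $ i * Y $ i $ k) \<and> (\<forall>j. j \<notin> K \<longrightarrow> X $ j = 0) \<and> \<mu> $ i0 = 0"
proof -
  let ?v = "calib_matrix i0 K A Y *v flatten \<mu> X"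
  have "?v $ Inl (i, k) = (A ** X) $ i $ k - \<mu> $ i * Y $ i $ k" for i k
    by (simp add: calib_matrix_def flatten_def matrix_vector_mult_def matrix_matrix_mult_def
        sum_UNIV_sum sum_UNIV_prod if_distrib[of "\<lambda>x. x * _"] cong: if_cong)
  moreover have "?v $ Inr (Inl (j, k)) = (if j \<notin> K then X $ j $ k else 0)" for j k
  proof -
    have "?v $ Inr (Inl (j, k)) =
        (\<Sum>c\<in>UNIV. calib_matrix i0 K A Y $ Inr (Inl (j, k)) $ c * flatten \<mu> X $ c)"
      by (simp add: matrix_vector_mult_def)
    also have "\<dots> = (\<Sum>c\<in>(UNIV :: ('n + 'm \<times> 'N) set). if c = Inr (j, k) then if j \<notin> K then X $ j $ k else 0 else 0)"
      by (rule sum.cong) (auto simp: calib_matrix_def flatten_def)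
    finally show ?thesis
      by simp
  qed
  moreover have "?v $ Inr (Inr u) = \<mu> $ i0" for u
  proof -
    have "?v $ Inr (Inr u) =
        (\<Sum>c\<in>UNIV. calib_matrix i0 K A Y $ Inr (Inr u) $ c * flatten \<mu> X $ c)"
      by (simp add: matrix_vector_mult_def)
    also have "\<dots> = (\<Sum>c\<in>(UNIV :: ('n + 'm \<times> 'N) set). if c = Inl i0 then \<mu> $ i0 else 0)"
      by (rule sum.cong) (auto simp: calib_matrix_def flatten_def)
    finally show ?thesis
      by simp
  qed
  ultimately show ?thesis
    by (auto simp: vec_eq_iff[of ?v] vec_eq_iff[of "X $ _"] split_sum_all)
qed

lemma flatten_surj: "\<exists>\<mu> X. v = flatten \<mu> X"
proof (intro exI)
  show "v = flatten (\<chi> i. v $ Inl i) (\<chi> j k. v $ Inr (j, k))"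
    by (auto simp: flatten_def vec_eq_iff split: sum.splits)
qed

lemma flatten_eq_0_iff: "flatten \<mu> X = 0 \<longleftrightarrow> \<mu> = 0 \<and> X = 0"
  by (auto simp: flatten_def vec_eq_iff split_sum_all)

lemma calib_matrix_injective_iff:
  fixes A :: "complex ^ 'm::finite ^ 'n::finite" and Y :: "complex ^ 'N::finite ^ 'n"
  shows "(\<forall>v. calib_matrix i0 K A Y *v v = 0 \<longrightarrow> v = 0) \<longleftrightarrow>
    (\<forall>\<mu> X. (\<forall>i k. (A ** X) $ i $ k = \<mu> $ i * Y $ i $ k) \<and> (\<forall>j. j \<notin> K \<longrightarrow> X $ j = 0) \<and> \<mu> $ i0 = 0
      \<longrightarrow> \<mu> = 0 \<and> X = 0)"
proof -
  have "(\<forall>v. calib_matrix i0 K A Y *v v = 0 \<longrightarrow> v = 0) \<longleftrightarrow>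
      (\<forall>\<mu> X. calib_matrix i0 K A Y *v flatten \<mu> X = 0 \<longrightarrow> flatten \<mu> X = 0)"
  proof safe
    fix v assume *: "\<forall>\<mu> X. calib_matrix i0 K A Y *v flatten \<mu> X = 0 \<longrightarrow> flatten \<mu> X = 0"
      and v: "calib_matrix i0 K A Y *v v = 0"
    obtain \<mu> X where "v = flatten \<mu> X"
      using flatten_surj[of v] by (elim exE)
    then show "v = 0"
      using * v by simp
  qed simp
  then show ?thesis
    by (simp only: calib_matrix_kernel_iff flatten_eq_0_iff)
qed

lemma poly_on_lines_calib_matrix:
  assumes "\<And>i j. poly_on_lines (\<lambda>x. A x $ i $ j)" and "\<And>i k. poly_on_lines (\<lambda>x. Y x $ i $ k)"
  shows "poly_on_lines (\<lambda>x. calib_matrix i0 K (A x) (Y x) $ i $ c)"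
proof -
  have "poly_on_lines (\<lambda>x. - Y x $ i $ k)" for i k
    using poly_on_lines_mult[OF poly_on_lines_const[of "-1"] assms(2)[of i k]] by simp
  then show ?thesis
    using assms(1)
    by (cases i; cases c) (auto simp: calib_matrix_def split: sum.split prod.split)
qed

section \<open>Generic triviality of the kernel\<close>

text \<open>The matrix entries are polynomial in \<open>A\<close> and in \<open>Z\<close>
  separately. With \<open>Z0\<close> fixed, almost every \<open>A\<close> gives injectivity at
  \<open>Z0\<close>; for each such \<open>A\<close>, the point \<open>Z0\<close> is itself the
  witness needed for almost every \<open>Z\<close>.\<close>

lemma AE_calib_injective:
  fixes J K :: "'m::finite set" and i0 :: "'n::finite"
  assumes "J \<subseteq> K" and "CARD('N::finite) \<le> card J" and "card K < CARD('n)"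
    and "CARD('n) - 1 \<le> CARD('N) * (CARD('n) - card K)"
  shows "AE A in (lborel :: (complex ^ 'm ^ 'n) measure). AE Z in (lborel :: (complex ^ 'N ^ 'm) measure).
    \<forall>\<mu> X. (\<forall>i k. (A ** X) $ i $ k = \<mu> $ i * (A ** rows_on J Z) $ i $ k) \<and> (\<forall>j. j \<notin> K \<longrightarrow> X $ j = 0) \<and> \<mu> $ i0 = 0
      \<longrightarrow> \<mu> = 0 \<and> X = 0"
proof -
  obtain A0 :: "complex ^ 'm ^ 'n" and Z0 :: "complex ^ 'N ^ 'm"
  where *: "\<And>\<mu> X. \<lbrakk>\<And>i k. (A0 ** X) $ i $ k = \<mu> $ i * (A0 ** rows_on J Z0) $ i $ k;
      \<And>j. j \<notin> K \<Longrightarrow> X $ j = 0; \<mu> $ i0 = 0\<rbrakk> \<Longrightarrow> \<mu> = 0 \<and> X = 0"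
    using ex_trivial_kernel[OF assms, of i0] by blast
  have "AE A in lborel. \<forall>v. calib_matrix i0 K A (A ** rows_on J Z0) *v v = 0 \<longrightarrow> v = 0"
  proof (rule AE_matrix_injective)
    show "v = 0" if "calib_matrix i0 K A0 (A0 ** rows_on J Z0) *v v = 0" for v
      using calib_matrix_injective_iff[of i0 K A0 "A0 ** rows_on J Z0"] * that by blast
    show "poly_on_lines (\<lambda>A. calib_matrix i0 K A (A ** rows_on J Z0) $ i $ j)" for i j
      by (intro poly_on_lines_calib_matrix poly_on_lines_linear)
        (auto simp: matrix_mult_rows_on_nth linear_iff distrib_right sum.distrib scaleR_sum_right)
  qed
  then show ?thesis
  proof eventually_elim
    case (elim A)
    show ?case
      unfolding calib_matrix_injective_iff[symmetric]
    proof (rule AE_matrix_injective)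
      show "v = 0" if "calib_matrix i0 K A (A ** rows_on J Z0) *v v = 0" for v
        using elim that by blast
      show "poly_on_lines (\<lambda>Z. calib_matrix i0 K A (A ** rows_on J Z) $ i $ j)" for i j
        by (intro poly_on_lines_calib_matrix poly_on_lines_const poly_on_lines_linear)
          (auto simp: matrix_mult_rows_on_nth linear_iff distrib_left sum.distrib scaleR_sum_right)
    qed
  qed
qed

text \<open>Nonzero entries in one column of \<open>A X\<^sub>0\<close> rule out zeros in \<lambda>,
  so that the quotient \<mu> can be formed.\<close>

lemma AE_product_entry_nonzero:
  fixes J :: "'m::finite set" and i :: "'n::finite" and k :: "'N::finite"
  assumes "J \<noteq> {}"
  shows "AE A in (lborel :: (complex ^ 'm ^ 'n) measure). AE Z in (lborel :: (complex ^ 'N ^ 'm) measure).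
    (A ** rows_on J Z) $ i $ k \<noteq> 0"
proof -
  obtain j where j: "j \<in> J"
    using assms by blast
  have "AE A in (lborel :: (complex ^ 'm ^ 'n) measure). A $ i $ j \<noteq> 0"
    by (rule AE_poly_on_lines_nonzero[of _ "\<chi> i j. 1"])
      (auto intro!: poly_on_lines_linear simp: linear_iff)
  then show ?thesis
  proof eventually_elim
    case (elim A)
    then have "(A ** rows_on J (\<chi> j' _. of_bool (j' = j))) $ i $ k \<noteq> 0"
      using j by (simp add: matrix_mult_rows_on_nth of_bool_def if_distrib cong: if_cong)
    then show ?case
      by (rule AE_poly_on_lines_nonzero[rotated], intro poly_on_lines_linear)
        (auto simp: matrix_mult_rows_on_nth linear_iff distrib_left sum.distrib scaleR_sum_right)
  qed
qed


section \<open>From trivial kernels to identifiability\<close>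

lemma diag_mat_mult_nth: "(diag_mat l ** B) $ i $ k = l $ i * B $ i $ k"
  for B :: "'a::semiring_1 ^ 'k ^ 'n::finite"
  by (simp add: diag_mat_def matrix_matrix_mult_def if_distrib[of "\<lambda>x. x * _"] cong: if_cong)

lemma AE_entries_nonzero: "AE l in (lborel :: (complex ^ 'n::finite) measure). \<forall>i. l $ i \<noteq> 0"
proof -
  have "AE l in (lborel :: (complex ^ 'n) measure). l $ i \<noteq> 0" for i
    by (rule AE_poly_on_lines_nonzero[of _ "\<chi> i. 1"])
      (auto intro!: poly_on_lines_linear simp: linear_iff)
  then show ?thesis
    by (simp add: AE_all_countable)
qed

lemma identifiable_of_trivial_kernel:
  fixes A :: "complex ^ 'm::finite ^ 'n::finite" and X X0 :: "complex ^ 'N::finite ^ 'm"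
  assumes l0: "\<And>i. l0 $ i \<noteq> 0" and Y: "\<And>i. (A ** X0) $ i $ k0 \<noteq> 0"
    and ker: "\<And>\<mu> X. \<lbrakk>\<And>i k. (A ** X) $ i $ k = \<mu> $ i * (A ** X0) $ i $ k;
      \<And>j. j \<notin> K \<Longrightarrow> X $ j = 0; \<mu> $ i0 = 0\<rbrakk> \<Longrightarrow> \<mu> = 0 \<and> X = 0"
    and supp: "\<And>j. j \<notin> K \<Longrightarrow> X $ j = 0" "\<And>j. j \<notin> K \<Longrightarrow> X0 $ j = 0"
    and eq: "diag_mat l ** A ** X = diag_mat l0 ** A ** X0"
  shows "\<exists>\<sigma>. \<sigma> \<noteq> 0 \<and> l = (\<chi> i. \<sigma> * l0 $ i) \<and> X = (\<chi> i j. (1 / \<sigma>) * X0 $ i $ j)"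
proof -
  have eq': "l $ i * (A ** X) $ i $ k = l0 $ i * (A ** X0) $ i $ k" for i k
    using arg_cong[OF eq, of "\<lambda>B. B $ i $ k"] by (simp add: matrix_mul_assoc[symmetric] diag_mat_mult_nth)
  have l: "l $ i \<noteq> 0" for i
    using eq'[of i k0] l0[of i] Y[of i] by auto
  define \<mu> where "\<mu> = (\<chi> i. l0 $ i / l $ i)"
  define c where "c = \<mu> $ i0"
  have AX: "(A ** X) $ i $ k = \<mu> $ i * (A ** X0) $ i $ k" for i k
    using eq'[of i k] l[of i] by (simp add: \<mu>_def field_simps)
  \<comment> \<open>Subtracting \<open>c\<close> times the known solution \<open>(1, X0)\<close>
    leaves a solution whose first component vanishes at \<open>i0\<close>.\<close>
  have "(\<chi> i. \<mu> $ i - c) = 0 \<and> (\<chi> j k. X $ j $ k - c * X0 $ j $ k) = 0"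
  proof (rule ker)
    fix i k
    have "(A ** (\<chi> j k. X $ j $ k - c * X0 $ j $ k)) $ i $ k = (A ** X) $ i $ k - c * (A ** X0) $ i $ k"
      by (simp add: matrix_matrix_mult_def sum_subtractf sum_distrib_left algebra_simps)
    then show "(A ** (\<chi> j k. X $ j $ k - c * X0 $ j $ k)) $ i $ k = (\<chi> i. \<mu> $ i - c) $ i * (A ** X0) $ i $ k"
      by (simp add: AX algebra_simps)
  qed (use supp in \<open>auto simp: c_def vec_eq_iff\<close>)
  then have \<mu>: "\<mu> $ i = c" and X: "X $ j $ k = c * X0 $ j $ k" for i j k
    by (simp_all add: vec_eq_iff)
  have "c \<noteq> 0"
    using l0[of i0] l[of i0] by (simp add: c_def \<mu>_def)
  moreover have "l $ i = 1 / c * l0 $ i" for i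
    using \<mu>[of i] l[of i] l0[of i] by (simp add: \<mu>_def field_simps)
  \<comment> \<open>The scalar is \<open>1 / c\<close> because \<mu> is the quotient of
    \<open>l0\<close> by \<open>l\<close>.\<close>
  ultimately show ?thesis
    by (intro exI[of _ "1 / c"]) (simp add: vec_eq_iff X)
qed

theorem theorem2:
  fixes s :: nat
  assumes "1 \<le> s" and "s \<le> CARD('m::finite)"
    and "CARD('n::finite) > 2 * s"
    and "(real CARD('n) - 1) / (real CARD('n) - 2 * real s) \<le> real CARD('N::finite)"
    and "CARD('N) \<le> s"
  shows "AE l0 in (lborel :: (complex ^ 'n) measure).
           AE A in (lborel :: (complex ^ 'm ^ 'n) measure).
             \<forall>J0 :: 'm set. card J0 = s \<longrightarrow>
               (AE Z in (lborel :: (complex ^ 'N ^ 'm) measure).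
                  (let X0 = rows_on J0 Z in
                   \<forall>(l :: complex ^ 'n) (X :: complex ^ 'N ^ 'm).
                     card (nonzero_rows X) \<le> s \<and>
                     diag_mat l ** A ** X = diag_mat l0 ** A ** X0 \<longrightarrow>
                     (\<exists>\<sigma>::complex. \<sigma> \<noteq> 0 \<and> l = (\<chi> i. \<sigma> * l0 $ i) \<and> X = (\<chi> i j. (1 / \<sigma>) * X0 $ i $ j))))"
proof -
  fix i0 :: 'n and k0 :: 'N
  define trivial_kernel where "trivial_kernel J K A Z \<longleftrightarrow>
    (\<forall>\<mu> (X :: complex ^ 'N ^ 'm). (\<forall>i k. (A ** X) $ i $ k = \<mu> $ i * (A ** rows_on J Z) $ i $ k) \<and>
      (\<forall>j. j \<notin> K \<longrightarrow> X $ j = 0) \<and> \<mu> $ i0 = 0 \<longrightarrow> \<mu> = 0 \<and> X = 0)"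
    for J K and A :: "complex ^ 'm ^ 'n" and Z
  have "real CARD('n) - 1 \<le> real CARD('N) * (real CARD('n) - 2 * real s)"
    using assms(3,4) by (simp add: field_simps)
  also have "\<dots> = real (CARD('N) * (CARD('n) - 2 * s))"
    using assms(3) by (simp add: of_nat_diff)
  finally have count: "CARD('n) - 1 \<le> CARD('N) * (CARD('n) - 2 * s)"
    by linarith
  have ker: "AE A in lborel. AE Z in lborel. trivial_kernel J K A Z"
    if "card J = s" "J \<subseteq> K" "card K \<le> 2 * s" for J K
    unfolding trivial_kernel_def
  proof (rule AE_calib_injective)
    show "CARD('n) - 1 \<le> CARD('N) * (CARD('n) - card K)"
      using count by (rule order_trans) (use that in \<open>auto intro!: mult_left_mono\<close>)
  qed (use that assms in auto)
  \<comment> \<open>There are finitely many sets \<open>J\<close> and \<open>K\<close>, so the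
    exceptional null sets can be united. All \<open>K\<close> are treated at once because the
    support of a competing \<open>X\<close> is not known in advance.\<close>
  have ae_A: "AE A in (lborel :: (complex ^ 'm ^ 'n) measure). \<forall>J. card J = s \<longrightarrow>
      (AE Z in (lborel :: (complex ^ 'N ^ 'm) measure). \<forall>i. (A ** rows_on J Z) $ i $ k0 \<noteq> 0) \<and>
      (AE Z in lborel. \<forall>K. J \<subseteq> K \<and> card K \<le> 2 * s \<longrightarrow> trivial_kernel J K A Z)"
    unfolding AE_all_countable
  proof (intro allI AE_impI AE_conjI)
    fix J :: "'m set" assume J: "card J = s"
    then have "J \<noteq> {}"
      using assms(1) by auto
    then show "AE A in (lborel :: (complex ^ 'm ^ 'n) measure). \<forall>i.
        AE Z in (lborel :: (complex ^ 'N ^ 'm) measure). (A ** rows_on J Z) $ i $ k0 \<noteq> 0"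
      unfolding AE_all_countable by (intro allI AE_product_entry_nonzero)
    show "AE A in lborel. \<forall>K. AE Z in lborel. J \<subseteq> K \<and> card K \<le> 2 * s \<longrightarrow> trivial_kernel J K A Z"
      unfolding AE_all_countable
    proof
      fix K
      show "AE A in lborel. AE Z in lborel. J \<subseteq> K \<and> card K \<le> 2 * s \<longrightarrow> trivial_kernel J K A Z"
        using ker[OF J, of K] by (cases "J \<subseteq> K \<and> card K \<le> 2 * s") auto
    qed
  qed
  show ?thesis
    using AE_entries_nonzero
  proof eventually_elim
    case l0: (elim l0)
    show ?case
      using ae_A
    proof eventually_elim
      case A: (elim A)
      show ?case
      proof (intro allI impI)
        fix J :: "'m set" assume J: "card J = s"
        have "AE Z in lborel. \<forall>i. (A ** rows_on J Z) $ i $ k0 \<noteq> 0"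
          and "AE Z in lborel. \<forall>K. J \<subseteq> K \<and> card K \<le> 2 * s \<longrightarrow> trivial_kernel J K A Z"
          using A J by blast+
        then show "AE Z in (lborel :: (complex ^ 'N ^ 'm) measure).
          (let X0 = rows_on J Z in
           \<forall>(l :: complex ^ 'n) (X :: complex ^ 'N ^ 'm).
             card (nonzero_rows X) \<le> s \<and> diag_mat l ** A ** X = diag_mat l0 ** A ** X0 \<longrightarrow>
             (\<exists>\<sigma>::complex. \<sigma> \<noteq> 0 \<and> l = (\<chi> i. \<sigma> * l0 $ i) \<and> X = (\<chi> i j. (1 / \<sigma>) * X0 $ i $ j)))"
        proof eventually_elim
          case (elim Z)
          show ?case
            unfolding Let_def
          proof (intro allI impI, elim conjE)
            fix l :: "complex ^ 'n" and X :: "complex ^ 'N ^ 'm"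
            assume X: "card (nonzero_rows X) \<le> s"
              and eq: "diag_mat l ** A ** X = diag_mat l0 ** A ** rows_on J Z"
            \<comment> \<open>This set supports both matrices, hence also their combination
              \<open>X - c X0\<close>.\<close>
            let ?K = "J \<union> nonzero_rows X"
            have "card ?K \<le> 2 * s"
              using card_Un_le[of J "nonzero_rows X"] J X by simp
            then have "trivial_kernel J ?K A Z"
              using elim(2) by blast
            then show "\<exists>\<sigma>. \<sigma> \<noteq> 0 \<and> l = (\<chi> i. \<sigma> * l0 $ i) \<and> X = (\<chi> i j. (1 / \<sigma>) * rows_on J Z $ i $ j)"
              using l0 elim(1) eq
              by (intro identifiable_of_trivial_kernel[of l0 A "rows_on J Z" k0 ?K i0 X l])
                (auto simp: trivial_kernel_def nonzero_rows_def rows_on_def)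
          qed
        qed
      qed
    qed
  qed
qed

end
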